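(* Let $\mathcal X$ and $\mathcal F$ be the unit balls of a finite-dimensional Euclidean space (norm $\|\cdot\|_2$, loss $\ell(f,x)=\langle f,x\rangle$). Let $D$ be the uniform distribution on the surface of the unit sphere and let $C=4\sqrt2$. Then for every $t\in\{1,\dots,T\}$, all $x_1,\dots,x_{t-1},x_{t+1},\dots,x_T\in\mathcal X$ and all $\epsilon_{t+1},\dots,\epsilon_T\in\{\pm1\}$, $$\sup_{p\in\Delta(\mathcal X)}\mathbb E_{x_t\sim p}\Big\|C\sum_{i=t+1}^T\epsilon_ix_i-\sum_{i=1}^{t-1}x_i+\mathbb E_{x\sim p}[x]-x_t\Big\|_2\le\mathbb E_{\epsilon_t,\,x_t\sim D}\Big\|C\sum_{i=t}^T\epsilon_ix_i-\sum_{i=1}^{t-1}x_i\Big\|_2 .$$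
   Context: $\Delta(\mathcal X)$ is the set of probability distributions on $\mathcal X$. On the right-hand side $\epsilon_t$ is a Rademacher (uniform $\pm1$) random variable independent of $x_t\sim D$. *)

theory Defs
  imports "HOL-Probability.Probability"
begin

definition prob_dists :: "'a::topological_space set \<Rightarrow> 'a measure set" where
  "prob_dists X = {p. prob_space p \<and> sets p = sets (restrict_space borel X)}"

definition rademacher :: "real pmf" where
  "rademacher = pmf_of_set {-1, 1}"

text \<open>
  Normalized surface measure on the unit sphere, taken as the cone measure: the mass of a Borel
  set \<open>A\<close> of unit vectors is the fraction of the volume of the unit ball that is filled by the
  cone over \<open>A\<close>. Equivalently, it is the law of \<open>y / norm y\<close> for \<open>y\<close> uniform on the ball; the
  value \<open>0\<close> at \<open>y = 0\<close> has mass zero. In dimension one this is the uniform distribution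
  on the two unit vectors.
\<close>

definition uniform_sphere :: "'a::euclidean_space measure" where
  "uniform_sphere = distr (uniform_measure lborel (ball 0 1)) borel (\<lambda>y. y /\<^sub>R norm y)"

lemma emeasure_unit_ball:
  "emeasure lborel (ball (0::'a::euclidean_space) 1) \<noteq> 0"
  "emeasure lborel (ball (0::'a::euclidean_space) 1) \<noteq> \<infinity>"
proof -
  have "measure lborel (ball (0::'a) 1) > 0"
    by (rule content_ball_pos) simp
  then show "emeasure lborel (ball (0::'a) 1) \<noteq> 0"
    by (auto simp: measure_def)
  show "emeasure lborel (ball (0::'a) 1) \<noteq> \<infinity>"
    using emeasure_bounded_finite[OF bounded_ball] by (metis infinity_ennreal_def less_irrefl)
qed

lemma sets_uniform_sphere [measurable_cong, simp]: "sets uniform_sphere = sets borel"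
  by (simp add: uniform_sphere_def)

lemma prob_space_uniform_sphere: "prob_space uniform_sphere"
  unfolding uniform_sphere_def
  by (intro prob_space.prob_space_distr prob_space_uniform_measure emeasure_unit_ball) simp_all

lemma AE_uniform_sphere: "AE y in (uniform_sphere :: 'a::euclidean_space measure). y \<in> sphere 0 1"
proof -
  have ne: "AE y in lborel. y \<noteq> (0::'a)"
    by (rule AE_lborel_singleton)
  have "AE y in uniform_measure lborel (ball 0 1). (y::'a) /\<^sub>R norm y \<in> sphere 0 1"
    by (rule AE_uniform_measureI) (use ne in \<open>auto elim!: eventually_mono\<close>)
  then show ?thesis
    unfolding uniform_sphere_def by (subst AE_distr_iff) auto
qed

end

theory Submission
  imports Defs
begin

text \<open>
  Write \<open>w\<close> for the part of the sum that does not depend on \<open>x\<^sub>t\<close>. If \<open>p\<close> has mean \<open>\<mu>\<close>, then \<open>\<mu> - x\<^sub>t\<close>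
  is centred with second moment at most \<open>1\<close>, so the left-hand side is at most \<open>sqrt (norm w ^ 2 + 1)\<close>
  by Jensen's inequality. On the right, averaging \<open>w + C y\<close> with the reflection of \<open>w - C y\<close> in the line
  through \<open>w\<close> removes the component of \<open>C y\<close> along \<open>w\<close>; with \<open>u\<close> the cosine of the angle between \<open>w\<close>
  and \<open>y\<close> this leaves \<open>sqrt (norm w ^ 2 + C ^ 2 * (1 - u ^ 2))\<close>. The square root is concave and \<open>u ^ 2\<close>
  has mean \<open>1 / n \<le> 1 / 2\<close> in dimension \<open>n \<ge> 2\<close>, so the right-hand side is at least the mean of
  \<open>sqrt (norm w ^ 2 + C ^ 2)\<close> and \<open>norm w\<close>, which suffices. In dimension one this bound
  degenerates; there both sides are compared with \<open>max (norm w) C\<close>, because for \<open>norm w \<ge> 2\<close> the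
  centred perturbation never changes the sign of \<open>w\<close>.
\<close>

section \<open>Invariance under signed coordinate permutations\<close>

text \<open>The preimage of a box is the box whose corners are permuted by the inverse of
  \<open>\<pi>\<close>; its volume is the same product in another order, and box volumes determine
  \<open>lborel\<close>.\<close>

lemma lborel_distr_permute_Basis:
  fixes \<pi> :: "'a::euclidean_space \<Rightarrow> 'a"
  assumes "\<pi> permutes Basis"
  shows "distr lborel borel (\<lambda>y. \<Sum>b\<in>Basis. (y \<bullet> \<pi> b) *\<^sub>R b) = (lborel :: 'a measure)"
proof -
  let ?f = "\<lambda>\<pi> (y::'a). \<Sum>b\<in>Basis. (y \<bullet> \<pi> b) *\<^sub>R b"
  let ?\<rho> = "inv_into UNIV \<pi>"
  have inv: "?\<rho> permutes Basis"
    by (rule permutes_inv[OF assms])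
  have meas: "?f \<pi> \<in> borel_measurable borel"
    by measurable
  have "lborel = distr lborel borel (?f \<pi>)"
  proof (rule lborel_eqI)
    fix l u :: 'a
    assume le: "\<And>b. b \<in> Basis \<Longrightarrow> l \<bullet> b \<le> u \<bullet> b"
    have in_B: "?\<rho> b \<in> Basis" if "b \<in> Basis" for b
      using permutes_in_image[OF inv] that by blast
    have in_B': "\<pi> b \<in> Basis" if "b \<in> Basis" for b
      using permutes_in_image[OF assms] that by blast
    have "?f \<pi> -` box l u = box (?f ?\<rho> l) (?f ?\<rho> u)"
    proof (intro set_eqI iffI)
      fix y assume "y \<in> ?f \<pi> -` box l u"
      then have *: "l \<bullet> b < y \<bullet> \<pi> b \<and> y \<bullet> \<pi> b < u \<bullet> b" if "b \<in> Basis" for b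
        using that by (simp add: mem_box)
      show "y \<in> box (?f ?\<rho> l) (?f ?\<rho> u)"
        using *[OF in_B] by (simp add: mem_box permutes_inverses[OF assms])
    next
      fix y assume "y \<in> box (?f ?\<rho> l) (?f ?\<rho> u)"
      then have *: "l \<bullet> ?\<rho> b < y \<bullet> b \<and> y \<bullet> b < u \<bullet> ?\<rho> b" if "b \<in> Basis" for b
        using that by (simp add: mem_box)
      show "y \<in> ?f \<pi> -` box l u"
        using *[OF in_B'] by (simp add: mem_box permutes_inverses[OF assms])
    qed
    then have "emeasure (distr lborel borel (?f \<pi>)) (box l u)
        = emeasure lborel (box (?f ?\<rho> l) (?f ?\<rho> u))"
      by (subst emeasure_distr) (use meas in auto)
    also have "\<dots> = (\<Prod>b\<in>Basis. (u - l) \<bullet> ?\<rho> b)"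
      using le in_B by (subst emeasure_lborel_box) (simp_all add: inner_diff_left)
    also have "(\<Prod>b\<in>Basis. (u - l) \<bullet> ?\<rho> b) = (\<Prod>b\<in>Basis. (u - l) \<bullet> b)"
      using prod.permute[OF inv, of "\<lambda>b. (u - l) \<bullet> b"] by (simp add: o_def)
    finally show "emeasure (distr lborel borel (?f \<pi>)) (box l u) = (\<Prod>b\<in>Basis. (u - l) \<bullet> b)" .
  qed simp
  then show ?thesis by simp
qed

text \<open>This is the linear change of variables with a diagonal matrix whose determinant has
  absolute value 1.\<close>

lemma lborel_distr_signs:
  fixes s :: "'a::euclidean_space \<Rightarrow> real"
  assumes "\<And>b. b \<in> Basis \<Longrightarrow> \<bar>s b\<bar> = 1"
  shows "distr lborel borel (\<lambda>y. \<Sum>b\<in>Basis. (s b * (y \<bullet> b)) *\<^sub>R b) = (lborel :: 'a measure)"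
proof -
  have ne: "s b \<noteq> 0" if "b \<in> Basis" for b
    using assms[OF that] by auto
  have "(lborel :: 'a measure) = density (distr lborel borel
      (\<lambda>y. 0 + (\<Sum>b\<in>Basis. (s b * (y \<bullet> b)) *\<^sub>R b))) (\<lambda>_. \<Prod>b\<in>Basis. \<bar>s b\<bar>)"
    by (rule lborel_affine_euclidean[OF ne])
  also have "(\<Prod>b\<in>Basis. \<bar>s b\<bar>) = 1"
    using assms by simp
  finally show ?thesis
    by (simp add: density_1)
qed

text \<open>A linear isometry commutes with \<open>y /\<^sub>R norm y\<close> and preserves the unit
  ball, so it carries cones to cones; equal volume then follows from the assumed invariance of
  \<open>lborel\<close>. That assumption is supplied below by coordinate swaps and sign
  flips.\<close>

lemma uniform_sphere_distr_isometry:
  fixes f :: "'a::euclidean_space \<Rightarrow> 'a"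
  assumes lin: "linear f" and norm: "\<And>y. norm (f y) = norm y"
    and inv: "distr lborel borel f = lborel"
  shows "distr uniform_sphere borel f = uniform_sphere"
proof (rule measure_eqI)
  have meas [measurable]: "f \<in> borel_measurable borel"
    by (intro borel_measurable_continuous_onI linear_continuous_on linear_conv_bounded_linear[THEN iffD1] lin)
  let ?k = "\<lambda>y::'a. y /\<^sub>R norm y"
  fix A :: "'a set"
  assume "A \<in> sets (distr uniform_sphere borel f)"
  then have A [measurable]: "A \<in> sets borel" by simp
  have fA [measurable]: "f -` A \<in> sets borel"
    using measurable_sets[OF meas A] by simp
  have kA: "?k -` B \<in> sets borel" if "B \<in> sets borel" for B
    using measurable_sets[of ?k borel borel B] that by simp
  have U: "emeasure uniform_sphere B = emeasure lborel (ball 0 1 \<inter> ?k -` B) / emeasure lborel (ball (0::'a) 1)"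
    if [measurable]: "B \<in> sets borel" for B
    unfolding uniform_sphere_def
    by (subst emeasure_distr) (use kA[OF that] in auto)
  have "ball 0 1 \<inter> ?k -` f -` A = f -` (ball 0 1 \<inter> ?k -` A)"
    by (auto simp: norm linear_scale[OF lin])
  also have "emeasure lborel \<dots> = emeasure (distr lborel borel f) (ball 0 1 \<inter> ?k -` A)"
    by (subst emeasure_distr) (use kA[OF A] in auto)
  finally have "emeasure lborel (ball 0 1 \<inter> ?k -` f -` A) = emeasure lborel (ball 0 1 \<inter> ?k -` A)"
    by (simp add: inv)
  then show "emeasure (distr uniform_sphere borel f) A = emeasure uniform_sphere A"
    by (subst emeasure_distr) (simp_all add: U)
qed simp

section \<open>Integration over the sphere\<close>

lemma integrable_uniform_sphere:
  fixes g :: "'a::euclidean_space \<Rightarrow> real"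
  assumes [measurable]: "g \<in> borel_measurable borel"
    and "\<And>y. norm y = 1 \<Longrightarrow> \<bar>g y\<bar> \<le> B"
  shows "integrable uniform_sphere g"
proof -
  interpret prob_space "uniform_sphere :: 'a measure"
    by (rule prob_space_uniform_sphere)
  show ?thesis
    by (rule integrable_const_bound[where B = B])
      (use AE_uniform_sphere in \<open>auto elim!: eventually_mono intro!: assms(2)\<close>)
qed

lemma integral_uniform_sphere_mono:
  fixes g h :: "'a::euclidean_space \<Rightarrow> real"
  assumes "integrable uniform_sphere g" "integrable uniform_sphere h"
    and "\<And>y. norm y = 1 \<Longrightarrow> g y \<le> h y"
  shows "(\<integral>y. g y \<partial>uniform_sphere) \<le> (\<integral>y. h y \<partial>uniform_sphere)"
  by (rule integral_mono_AE[OF assms(1,2)])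
    (use AE_uniform_sphere in \<open>auto elim!: eventually_mono intro!: assms(3)\<close>)

lemma integrable_uniform_sphere_inner_mult:
  fixes a b :: "'a::euclidean_space"
  shows "integrable uniform_sphere (\<lambda>y. (y \<bullet> a) * (y \<bullet> b))"
proof (rule integrable_uniform_sphere[where B = "norm a * norm b"])
  fix y :: 'a assume "norm y = 1"
  then show "\<bar>(y \<bullet> a) * (y \<bullet> b)\<bar> \<le> norm a * norm b"
    using Cauchy_Schwarz_ineq2[of y a] Cauchy_Schwarz_ineq2[of y b]
    by (simp add: abs_mult mult_mono)
qed simp

lemma integral_uniform_sphere_isometry:
  fixes f :: "'a::euclidean_space \<Rightarrow> 'a" and g :: "'a \<Rightarrow> real"
  assumes lin: "linear f" and "\<And>y. norm (f y) = norm y"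
    and "distr lborel borel f = lborel"
    and "g \<in> borel_measurable borel"
  shows "(\<integral>y. g (f y) \<partial>uniform_sphere) = (\<integral>y. g y \<partial>uniform_sphere)"
proof -
  have "f \<in> borel_measurable borel"
    by (intro borel_measurable_continuous_onI linear_continuous_on linear_conv_bounded_linear[THEN iffD1] lin)
  then have "(\<integral>y. g y \<partial>distr uniform_sphere borel f) = (\<integral>y. g (f y) \<partial>uniform_sphere)"
    by (intro integral_distr) (use assms(4) in auto)
  then show ?thesis
    by (simp add: uniform_sphere_distr_isometry[OF assms(1-3)])
qed

section \<open>Second moments of the uniform distribution on the sphere\<close>

lemma norm_eq_sum_Basis_sq: "norm (y::'a::euclidean_space) = sqrt (\<Sum>b\<in>Basis. (y \<bullet> b)\<^sup>2)"
  by (subst euclidean_dist_l2[of y 0, simplified]) (simp add: L2_set_def)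

text \<open>Flipping the sign of coordinate \<open>i\<close> negates the integrand but preserves the
  measure.\<close>

lemma uniform_sphere_moment_off_diagonal:
  fixes i j :: "'a::euclidean_space"
  assumes "i \<in> Basis" "j \<in> Basis" "i \<noteq> j"
  shows "(\<integral>y. (y \<bullet> i) * (y \<bullet> j) \<partial>uniform_sphere) = 0"
proof -
  define s :: "'a \<Rightarrow> real" where "s b = (if b = i then -1 else 1)" for b
  let ?f = "\<lambda>y::'a. \<Sum>b\<in>Basis. (s b * (y \<bullet> b)) *\<^sub>R b"
  have "linear ?f"
    by (intro linearI)
      (simp_all add: inner_add_left scaleR_sum_right scaleR_left_distrib algebra_simps flip: sum.distrib)
  moreover have "norm (?f y) = norm y" for y
    by (auto simp: norm_eq_sum_Basis_sq s_def intro!: sum.cong)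
  moreover have "distr lborel borel ?f = lborel"
    by (rule lborel_distr_signs) (simp add: s_def)
  ultimately have "(\<integral>y. (?f y \<bullet> i) * (?f y \<bullet> j) \<partial>uniform_sphere) = (\<integral>y. (y \<bullet> i) * (y \<bullet> j) \<partial>uniform_sphere)"
    by (rule integral_uniform_sphere_isometry) simp
  then show ?thesis
    using assms by (simp add: s_def)
qed

text \<open>Swapping two coordinates shows that all these moments agree, and they add up to the mean
  of \<open>norm y ^ 2\<close>, which is 1.\<close>

lemma uniform_sphere_moment_diagonal:
  fixes i :: "'a::euclidean_space"
  assumes i: "i \<in> Basis"
  shows "(\<integral>y. (y \<bullet> i)\<^sup>2 \<partial>uniform_sphere) = 1 / DIM('a)"
proof -
  interpret prob_space "uniform_sphere :: 'a measure"
    by (rule prob_space_uniform_sphere)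
  have same: "(\<integral>y. (y \<bullet> j)\<^sup>2 \<partial>uniform_sphere) = (\<integral>y. (y \<bullet> i)\<^sup>2 \<partial>uniform_sphere)" if j: "j \<in> Basis" for j :: 'a
  proof -
    let ?\<pi> = "Transposition.transpose i j"
    let ?f = "\<lambda>y::'a. \<Sum>b\<in>Basis. (y \<bullet> ?\<pi> b) *\<^sub>R b"
    have perm: "?\<pi> permutes Basis"
      by (rule permutes_swap_id[OF i j])
    have "linear ?f"
      by (intro linearI)
        (simp_all add: inner_add_left scaleR_sum_right scaleR_left_distrib algebra_simps flip: sum.distrib)
    moreover have "norm (?f y) = norm y" for y
      using sum.permute[OF perm, of "\<lambda>b. (y \<bullet> b)\<^sup>2"] by (simp add: norm_eq_sum_Basis_sq o_def)
    moreover have "distr lborel borel ?f = lborel"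
      by (rule lborel_distr_permute_Basis[OF perm])
    ultimately have "(\<integral>y. (?f y \<bullet> i)\<^sup>2 \<partial>uniform_sphere) = (\<integral>y. (y \<bullet> i)\<^sup>2 \<partial>uniform_sphere)"
      by (rule integral_uniform_sphere_isometry) simp
    then show ?thesis
      using i by simp
  qed
  have int: "integrable uniform_sphere (\<lambda>y::'a. (y \<bullet> b)\<^sup>2)" for b
    using integrable_uniform_sphere_inner_mult[of b b] by (simp add: power2_eq_square)
  have "DIM('a) * (\<integral>y. (y \<bullet> i)\<^sup>2 \<partial>uniform_sphere) = (\<Sum>j\<in>Basis. \<integral>y. (y \<bullet> j)\<^sup>2 \<partial>(uniform_sphere :: 'a measure))"
    using same by simp
  also have "\<dots> = (\<integral>y. (\<Sum>j\<in>Basis. (y \<bullet> j)\<^sup>2) \<partial>(uniform_sphere :: 'a measure))"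
    by (rule Bochner_Integration.integral_sum[symmetric]) (rule int)
  also have "\<dots> = (\<integral>y. 1 \<partial>(uniform_sphere :: 'a measure))"
  proof (rule integral_cong_AE)
    show "AE y in (uniform_sphere :: 'a measure). (\<Sum>j\<in>Basis. (y \<bullet> j)\<^sup>2) = 1"
      using AE_uniform_sphere
      by (rule eventually_mono) (simp add: norm_eq_sum_Basis_sq)
  qed simp_all
  also have "\<dots> = 1"
    using prob_space by simp
  finally show ?thesis
    by (simp add: field_simps)
qed

text \<open>Expanding in the basis leaves a quadratic form in \<open>e\<close> whose matrix is the
  identity divided by the dimension. This gives the moment in an arbitrary direction without general
  rotation invariance.\<close>

lemma uniform_sphere_second_moment:
  fixes e :: "'a::euclidean_space"
  shows "(\<integral>y. (y \<bullet> e)\<^sup>2 \<partial>uniform_sphere) = (norm e)\<^sup>2 / DIM('a)"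
proof -
  have exp: "(y \<bullet> e)\<^sup>2 = (\<Sum>i\<in>Basis. \<Sum>j\<in>Basis. (e \<bullet> i) * (e \<bullet> j) * ((y \<bullet> i) * (y \<bullet> j)))" for y
    unfolding power2_eq_square euclidean_inner[of y e] sum_product
    by (intro sum.cong) simp_all
  have "(\<integral>y. (y \<bullet> e)\<^sup>2 \<partial>uniform_sphere)
      = (\<Sum>i\<in>Basis. \<Sum>j\<in>Basis. (e \<bullet> i) * (e \<bullet> j) * (\<integral>y. (y \<bullet> i) * (y \<bullet> j) \<partial>uniform_sphere))"
    unfolding exp
    by (simp add: integrable_uniform_sphere_inner_mult)
  also have "\<dots> = (\<Sum>i\<in>Basis. \<Sum>j\<in>Basis. if j = i then (e \<bullet> i)\<^sup>2 / DIM('a) else 0)"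
    by (intro sum.cong refl)
      (use uniform_sphere_moment_diagonal[where 'a = 'a] in \<open>auto simp: uniform_sphere_moment_off_diagonal power2_eq_square\<close>)
  also have "\<dots> = (\<Sum>i\<in>Basis. (e \<bullet> i)\<^sup>2) / DIM('a)"
    by (simp add: sum_divide_distrib)
  also have "(\<Sum>i\<in>Basis. (e \<bullet> i)\<^sup>2) = (norm e)\<^sup>2"
    by (simp add: norm_eq_sum_Basis_sq sum_nonneg)
  finally show ?thesis .
qed

section \<open>Lower bounds for the average over the sphere\<close>

text \<open>Concavity of the square root: after squaring, the two sides differ by
  \<open>v * (1 - v) * (sqrt a - sqrt b) ^ 2\<close>.\<close>

lemma sqrt_chord_le:
  fixes a b v :: real
  assumes "0 \<le> a" "0 \<le> b" "0 \<le> v" "v \<le> 1"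
  shows "(1 - v) * sqrt a + v * sqrt b \<le> sqrt ((1 - v) * a + v * b)"
proof (rule real_le_rsqrt)
  have "(1 - v) * p\<^sup>2 + v * q\<^sup>2 - ((1 - v) * p + v * q)\<^sup>2 = v * (1 - v) * (p - q)\<^sup>2" for p q
    by (simp add: power2_eq_square algebra_simps)
  from this[of "sqrt a" "sqrt b"]
  have "(1 - v) * a + v * b - ((1 - v) * sqrt a + v * sqrt b)\<^sup>2 = v * (1 - v) * (sqrt a - sqrt b)\<^sup>2"
    using assms by simp
  moreover have "\<dots> \<ge> 0"
    using assms by simp
  ultimately show "((1 - v) * sqrt a + v * sqrt b)\<^sup>2 \<le> (1 - v) * a + v * b"
    by linarith
qed

text \<open>With \<open>u = y \<bullet> e\<close>, reflection and the triangle inequality give the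
  bound \<open>sqrt (r ^ 2 + c ^ 2 * (1 - u ^ 2))\<close>. It is weakened to a chord because the
  chord is affine in \<open>u ^ 2\<close>, so that its integral needs the second moment
  alone.\<close>

lemma norm_add_diff_ge:
  fixes e y :: "'a::real_inner" and r c :: real
  assumes e: "norm e = 1" and y: "norm y = 1" and r: "r \<ge> 0"
  shows "(1 - (y \<bullet> e)\<^sup>2) * sqrt (r\<^sup>2 + c\<^sup>2) + (y \<bullet> e)\<^sup>2 * r
    \<le> (norm (r *\<^sub>R e + c *\<^sub>R y) + norm (r *\<^sub>R e - c *\<^sub>R y)) / 2"
proof -
  define u where "u = y \<bullet> e"
  have ee: "e \<bullet> e = 1" and yy: "y \<bullet> y = 1"
    using e y by (simp_all add: norm_eq_1)
  have u1: "u\<^sup>2 \<le> 1"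
    using Cauchy_Schwarz_ineq[of y e] by (simp add: u_def ee yy)
  let ?p = "y - u *\<^sub>R e"
  have "(norm (r *\<^sub>R e - c *\<^sub>R y))\<^sup>2 = (norm (r *\<^sub>R e - (c * u) *\<^sub>R e + c *\<^sub>R ?p))\<^sup>2"
    unfolding power2_norm_eq_inner
    by (simp add: inner_simps ee yy inner_commute[of e y] flip: u_def) algebra
  \<comment> \<open>the reflection in the line spanned by \<open>e\<close>\<close>
  then have refl: "norm (r *\<^sub>R e - c *\<^sub>R y) = norm (r *\<^sub>R e - (c * u) *\<^sub>R e + c *\<^sub>R ?p)"
    by simp
  have "(1 - u\<^sup>2) * sqrt (r\<^sup>2 + c\<^sup>2) + u\<^sup>2 * r = (1 - u\<^sup>2) * sqrt (r\<^sup>2 + c\<^sup>2) + u\<^sup>2 * sqrt (r\<^sup>2)"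
    using r by simp
  also have "\<dots> \<le> sqrt ((1 - u\<^sup>2) * (r\<^sup>2 + c\<^sup>2) + u\<^sup>2 * r\<^sup>2)"
    by (rule sqrt_chord_le) (use u1 in auto)
  also have "(1 - u\<^sup>2) * (r\<^sup>2 + c\<^sup>2) + u\<^sup>2 * r\<^sup>2 = (norm (r *\<^sub>R e + c *\<^sub>R ?p))\<^sup>2"
    unfolding power2_norm_eq_inner
    by (simp add: inner_simps ee yy inner_commute[of e y] flip: u_def) algebra
  also have "sqrt \<dots> = norm (2 *\<^sub>R (r *\<^sub>R e + c *\<^sub>R ?p)) / 2"
    by (simp del: scaleR_add_right scaleR_diff_right)
  also have "2 *\<^sub>R (r *\<^sub>R e + c *\<^sub>R ?p) = (r *\<^sub>R e + c *\<^sub>R y) + (r *\<^sub>R e - (c * u) *\<^sub>R e + c *\<^sub>R ?p)"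
    unfolding scaleR_2 by (simp add: algebra_simps)
  also have "norm \<dots> / 2 \<le> (norm (r *\<^sub>R e + c *\<^sub>R y) + norm (r *\<^sub>R e - c *\<^sub>R y)) / 2"
    unfolding refl by (intro divide_right_mono norm_triangle_ineq) simp
  finally show ?thesis
    by (simp add: u_def)
qed

lemma integrable_uniform_sphere_norm:
  "integrable uniform_sphere (\<lambda>y::'a::euclidean_space. norm (w + c *\<^sub>R y))"
proof (rule integrable_uniform_sphere[where B = "norm w + \<bar>c\<bar>"])
  fix y :: 'a assume "norm y = 1"
  then show "\<bar>norm (w + c *\<^sub>R y)\<bar> \<le> norm w + \<bar>c\<bar>"
    using norm_triangle_ineq[of w "c *\<^sub>R y"] by simp
qed simp

lemma integrable_uniform_sphere_average:
  "integrable uniform_sphere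
    (\<lambda>y::'a::euclidean_space. (norm (w + c *\<^sub>R y) + norm (w - c *\<^sub>R y)) / 2)"
  using integrable_uniform_sphere_norm[of w c] integrable_uniform_sphere_norm[of w "- c"] by simp

text \<open>The bound is pointwise: the two vectors have sum \<open>2 *\<^sub>R w\<close> and
  difference \<open>(2 * c) *\<^sub>R y\<close>.\<close>

lemma uniform_sphere_average_ge_max:
  fixes w :: "'a::euclidean_space"
  assumes "c \<ge> 0"
  shows "max (norm w) c \<le> (\<integral>y. (norm (w + c *\<^sub>R y) + norm (w - c *\<^sub>R y)) / 2 \<partial>uniform_sphere)"
proof -
  interpret prob_space "uniform_sphere :: 'a measure"
    by (rule prob_space_uniform_sphere)
  have "(\<integral>y. max (norm w) c \<partial>(uniform_sphere :: 'a measure))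
      \<le> (\<integral>y. (norm (w + c *\<^sub>R y) + norm (w - c *\<^sub>R y)) / 2 \<partial>uniform_sphere)"
  proof (rule integral_uniform_sphere_mono[OF _ integrable_uniform_sphere_average])
    fix y :: 'a assume y: "norm y = 1"
    have "norm (2 *\<^sub>R w) \<le> norm (w + c *\<^sub>R y) + norm (w - c *\<^sub>R y)"
      using norm_triangle_ineq[of "w + c *\<^sub>R y" "w - c *\<^sub>R y"] by (simp add: scaleR_2)
    moreover have "norm ((2 * c) *\<^sub>R y) \<le> norm (w + c *\<^sub>R y) + norm (w - c *\<^sub>R y)"
      using norm_triangle_ineq4[of "w + c *\<^sub>R y" "w - c *\<^sub>R y"]
      by (simp add: algebra_simps flip: scaleR_2)
    ultimately show "max (norm w) c \<le> (norm (w + c *\<^sub>R y) + norm (w - c *\<^sub>R y)) / 2"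
      using y assms by simp
  qed simp
  then show ?thesis
    by (simp add: prob_space)
qed

lemma uniform_sphere_average_ge_sqrt:
  fixes w :: "'a::euclidean_space"
  assumes dim: "DIM('a) \<ge> 2" and c: "c\<^sup>2 \<ge> 4"
  shows "sqrt ((norm w)\<^sup>2 + 1) \<le> (\<integral>y. (norm (w + c *\<^sub>R y) + norm (w - c *\<^sub>R y)) / 2 \<partial>uniform_sphere)"
proof -
  interpret prob_space "uniform_sphere :: 'a measure"
    by (rule prob_space_uniform_sphere)
  define r where "r = norm w"
  \<comment> \<open>For \<open>w = 0\<close> there is no preferred direction, and any unit vector
    serves.\<close>
  obtain e where e: "norm e = 1" and w: "w = r *\<^sub>R e"
  proof (cases "w = 0")
    case True
    then show ?thesis
      using that[OF norm_Basis[OF SOME_Basis]] by (simp add: r_def)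
  next
    case False
    then show ?thesis
      using that[of "sgn w"] by (simp add: r_def norm_sgn sgn_div_norm)
  qed
  have r: "r \<ge> 0" by (simp add: r_def)
  define S where "S = sqrt (r\<^sup>2 + c\<^sup>2)"
  have rS: "r \<le> S"
    unfolding S_def by (rule real_le_rsqrt) simp
  have int: "integrable uniform_sphere (\<lambda>y::'a. (y \<bullet> e)\<^sup>2)"
    using integrable_uniform_sphere_inner_mult[of e e] by (simp add: power2_eq_square)
  \<comment> \<open>Since \<open>S \<ge> r\<close>, the square of the right-hand side is at least
    \<open>r ^ 2 + c ^ 2 / 4\<close>; this is where \<open>c ^ 2 \<ge> 4\<close> enters.\<close>
  have "sqrt (r\<^sup>2 + 1) \<le> (S + r) / 2"
  proof (rule real_le_lsqrt)
    show "(S + r) / 2 \<ge> 0" using r rS by simp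
    have "r * r \<le> r * S" using r rS by (rule mult_left_mono[rotated])
    moreover have "S\<^sup>2 = r\<^sup>2 + c\<^sup>2" by (simp add: S_def)
    ultimately show "r\<^sup>2 + 1 \<le> ((S + r) / 2)\<^sup>2"
      using c by (simp add: power2_eq_square algebra_simps)
  qed
  also have "(S + r) / 2 = S - 1 / 2 * (S - r)"
    by (simp add: field_simps)
  \<comment> \<open>The dimension bound enters here: \<open>1 / DIM('a) \<le> 1 / 2\<close> and
    \<open>S - r \<ge> 0\<close>. The new factor is the mean of
    \<open>(y \<bullet> e) ^ 2\<close>.\<close>
  also have "\<dots> \<le> S - 1 / DIM('a) * (S - r)"
    using dim rS by (intro diff_left_mono mult_right_mono) (auto simp: field_simps)
  also have "\<dots> = (\<integral>y. S - (y \<bullet> e)\<^sup>2 * (S - r) \<partial>uniform_sphere)"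
    using int by (simp add: uniform_sphere_second_moment e prob_space)
  also have "\<dots> = (\<integral>y. (1 - (y \<bullet> e)\<^sup>2) * S + (y \<bullet> e)\<^sup>2 * r \<partial>uniform_sphere)"
    by (intro Bochner_Integration.integral_cong) (simp_all add: algebra_simps)
  also have "\<dots> \<le> (\<integral>y. (norm (w + c *\<^sub>R y) + norm (w - c *\<^sub>R y)) / 2 \<partial>uniform_sphere)"
    by (rule integral_uniform_sphere_mono[OF _ integrable_uniform_sphere_average])
      (use int norm_add_diff_ge[OF e _ r] in \<open>simp_all add: w S_def\<close>)
  finally show ?thesis
    by (simp add: r_def)
qed

section \<open>Upper bounds for centred perturbations\<close>

text \<open>The space of \<open>p\<close> is the ball itself, so \<open>norm y \<le> 1\<close> holds
  at every point of it and both claims follow from this bound.\<close>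

lemma
  fixes p :: "'a::euclidean_space measure"
  assumes "p \<in> prob_dists (cball 0 1)"
  shows integrable_prob_dists_cball: "integrable p (\<lambda>y. y)"
    and norm_mean_prob_dists_cball: "norm (\<integral>y. y \<partial>p) \<le> 1"
proof -
  from assms have sets: "sets p = sets (restrict_space borel (cball 0 1))"
    by (simp add: prob_dists_def)
  from assms interpret prob_space p
    by (simp add: prob_dists_def)
  have sp: "space p = cball 0 1"
    using sets_eq_imp_space_eq[OF sets] by (simp add: space_restrict_space)
  have [measurable]: "(\<lambda>y. y) \<in> borel_measurable p"
    unfolding measurable_cong_sets[OF sets refl] by (rule measurable_restrict_space1) simp
  show int: "integrable p (\<lambda>y. y)"
    by (rule integrable_const_bound[where B = 1]) (auto simp: sp)
  have "norm (\<integral>y. y \<partial>p) \<le> (\<integral>y. norm y \<partial>p)"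
    by (rule integral_norm_bound)
  also have "\<dots> \<le> (\<integral>y. 1 \<partial>p)"
    by (rule integral_mono) (use int sp in auto)
  finally show "norm (\<integral>y. y \<partial>p) \<le> 1"
    by (simp add: prob_space)
qed

text \<open>Jensen's inequality is applied through the tangent bound
  \<open>norm v \<le> (norm v ^ 2 + s ^ 2) / (2 * s)\<close>, which is tight at
  \<open>norm v = s\<close>.\<close>

lemma prob_dists_cball_norm_le_sqrt:
  fixes p :: "'a::euclidean_space measure"
  assumes p: "p \<in> prob_dists (cball 0 1)"
  shows "(\<integral>y. norm (w + (\<integral>z. z \<partial>p) - y) \<partial>p) \<le> sqrt ((norm w)\<^sup>2 + 1)"
proof -
  from p interpret prob_space p
    by (simp add: prob_dists_def)
  have sp: "space p = cball 0 1"
    using p sets_eq_imp_space_eq[of p] by (force simp: prob_dists_def space_restrict_space)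
  note int = integrable_prob_dists_cball[OF p]
  define \<mu> where "\<mu> = (\<integral>z. z \<partial>p)"
  define s where "s = sqrt ((norm w)\<^sup>2 + 1)"
  have s: "s > 0" "s\<^sup>2 = (norm w)\<^sup>2 + 1"
    by (simp_all add: s_def add_nonneg_pos)
  \<comment> \<open>The tangent bound with \<open>norm y ^ 2\<close> replaced by 1. It is affine in
    \<open>y\<close>, so integrating it only inserts the mean.\<close>
  let ?q = "\<lambda>y. ((norm (w + \<mu>))\<^sup>2 - 2 * ((w + \<mu>) \<bullet> y) + 1 + s\<^sup>2) / (2 * s)"
  have intq: "integrable p ?q"
    using int by simp
  have "(\<integral>y. norm (w + \<mu> - y) \<partial>p) \<le> (\<integral>y. ?q y \<partial>p)"
  proof (rule integral_mono[OF _ intq])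
    show "integrable p (\<lambda>y. norm (w + \<mu> - y))"
      using int by simp
    fix y assume "y \<in> space p"
    then have "(norm y)\<^sup>2 \<le> 1"
      by (simp add: sp power_le_one)
    moreover have "(norm (w + \<mu> - y))\<^sup>2 = (norm (w + \<mu>))\<^sup>2 - 2 * ((w + \<mu>) \<bullet> y) + (norm y)\<^sup>2"
      unfolding power2_norm_eq_inner by (simp add: inner_simps inner_commute)
    moreover have "2 * s * norm (w + \<mu> - y) \<le> (norm (w + \<mu> - y))\<^sup>2 + s\<^sup>2"
      using sum_squares_bound[of s "norm (w + \<mu> - y)"] by simp
    ultimately show "norm (w + \<mu> - y) \<le> ?q y"
      using s by (simp add: field_simps)
  qed
  also have "(\<integral>y. ?q y \<partial>p) = ((norm (w + \<mu>))\<^sup>2 - 2 * ((w + \<mu>) \<bullet> \<mu>) + 1 + s\<^sup>2) / (2 * s)"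
    using int by (simp add: prob_space \<mu>_def)
  \<comment> \<open>The cross terms cancel because the perturbation is centred; the remaining
    \<open>- norm \<mu> ^ 2\<close> is dropped in the next estimate.\<close>
  also have "(norm (w + \<mu>))\<^sup>2 - 2 * ((w + \<mu>) \<bullet> \<mu>) = (norm w)\<^sup>2 - (norm \<mu>)\<^sup>2"
    unfolding power2_norm_eq_inner by (simp add: inner_simps inner_commute)
  also have "((norm w)\<^sup>2 - (norm \<mu>)\<^sup>2 + 1 + s\<^sup>2) / (2 * s) \<le> (2 * s\<^sup>2) / (2 * s)"
    using s by (intro divide_right_mono) auto
  also have "\<dots> = s"
    using s(1) by (simp add: power2_eq_square)
  finally show ?thesis
    by (simp add: \<mu>_def s_def)
qed

text \<open>The perturbation \<open>\<mu> - y\<close> has norm at most 2. If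
  \<open>norm w \<ge> 2\<close>, the norm is affine over its range and the centred perturbation
  averages out; otherwise the norm is at most 2 + 2 pointwise, which gives the constant 4.\<close>

lemma prob_dists_cball_norm_le_max_dim1:
  fixes p :: "'a::euclidean_space measure"
  assumes p: "p \<in> prob_dists (cball 0 1)" and dim: "DIM('a) = 1"
  shows "(\<integral>y. norm (w + (\<integral>z. z \<partial>p) - y) \<partial>p) \<le> max (norm w) 4"
proof -
  from p interpret prob_space p
    by (simp add: prob_dists_def)
  have sp: "space p = cball 0 1"
    using p sets_eq_imp_space_eq[of p] by (force simp: prob_dists_def space_restrict_space)
  note int = integrable_prob_dists_cball[OF p]
  define \<mu> where "\<mu> = (\<integral>z. z \<partial>p)"
  have \<mu>: "norm \<mu> \<le> 1"
    unfolding \<mu>_def by (rule norm_mean_prob_dists_cball[OF p])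
  have near: "norm (\<mu> - y) \<le> 2" if "y \<in> space p" for y
    using norm_triangle_ineq4[of \<mu> y] \<mu> that by (simp add: sp)
  have int': "integrable p (\<lambda>y. norm (w + \<mu> - y))"
    using int by simp
  have "(\<integral>y. norm (w + \<mu> - y) \<partial>p) \<le> max (norm w) 4"
  proof (cases "norm w \<ge> 2")
    case True
    obtain b :: 'a where b: "Basis = {b}"
      using dim by (auto simp: card_1_singleton_iff)
    have norm_b: "norm v = \<bar>v \<bullet> b\<bar>" for v :: 'a
      by (simp add: norm_eq_sum_Basis_sq b)
    \<comment> \<open>On a line, \<open>\<sigma>\<close> is the slope of the absolute value on the
      side of 0 where \<open>w\<close> lies.\<close>
    define \<sigma> where "\<sigma> = sgn (w \<bullet> b)"
    have "norm (w + \<mu> - y) = norm w + \<sigma> * ((\<mu> - y) \<bullet> b)" if "y \<in> space p" for y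
      using near[OF that] True
      by (auto simp: norm_b \<sigma>_def inner_simps sgn_if abs_if split: if_splits)
    then have "(\<integral>y. norm (w + \<mu> - y) \<partial>p) = (\<integral>y. norm w + \<sigma> * ((\<mu> - y) \<bullet> b) \<partial>p)"
      by (intro Bochner_Integration.integral_cong) simp_all
    also have "\<dots> = norm w"
      using int by (simp add: prob_space inner_diff_left) (simp add: \<mu>_def)
    finally show ?thesis by simp
  next
    case False
    have "(\<integral>y. norm (w + \<mu> - y) \<partial>p) \<le> (\<integral>y. 4 \<partial>p)"
    proof (rule integral_mono[OF int'])
      fix y assume "y \<in> space p"
      then show "norm (w + \<mu> - y) \<le> 4"
        using near[of y] False norm_triangle_ineq[of w "\<mu> - y"] by (simp add: add_diff_eq)
    qed simp
    then show ?thesis by (simp add: prob_space)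
  qed
  then show ?thesis by (simp add: \<mu>_def)
qed

section \<open>The random sign and the final comparison\<close>

text \<open>Fubini's theorem and the two equally likely signs turn the product expectation into the
  symmetric average bounded above.\<close>

lemma integral_rademacher_uniform_sphere:
  fixes w :: "'a::euclidean_space"
  shows "(\<integral>(e, y). norm (w + (c * e) *\<^sub>R y) \<partial>(measure_pmf rademacher \<Otimes>\<^sub>M uniform_sphere))
    = (\<integral>y. (norm (w + c *\<^sub>R y) + norm (w - c *\<^sub>R y)) / 2 \<partial>uniform_sphere)"
proof -
  interpret U: prob_space "uniform_sphere :: 'a measure"
    by (rule prob_space_uniform_sphere)
  interpret pair_prob_space "measure_pmf rademacher" "uniform_sphere :: 'a measure" ..
  have set_r: "set_pmf rademacher = {-1, 1}"
    by (simp add: rademacher_def set_pmf_of_set)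
  have pmf_r: "pmf rademacher 1 = 1 / 2" "pmf rademacher (-1) = 1 / 2"
    by (simp_all add: rademacher_def pmf_of_set)
  let ?F = "\<lambda>(e, y::'a). norm (w + (c * e) *\<^sub>R y)"
  have meas: "?F \<in> borel_measurable (measure_pmf rademacher \<Otimes>\<^sub>M uniform_sphere)"
  proof -
    have [measurable]: "(\<lambda>e. e) \<in> borel_measurable (measure_pmf rademacher)" by simp
    show ?thesis by measurable
  qed
  have "integrable (measure_pmf rademacher \<Otimes>\<^sub>M uniform_sphere) ?F"
    by (rule Fubini_integrable[OF meas])
      (auto intro!: integrable_measure_pmf_finite integrable_uniform_sphere_norm simp: set_r)
  then have "integral\<^sup>L (measure_pmf rademacher \<Otimes>\<^sub>M uniform_sphere) ?F
      = (\<integral>e. \<integral>y. norm (w + (c * e) *\<^sub>R y) \<partial>uniform_sphere \<partial>measure_pmf rademacher)"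
    by (subst integral_fst'[symmetric]) simp_all
  also have "\<dots> = ((\<integral>y. norm (w + c *\<^sub>R y) \<partial>uniform_sphere) + (\<integral>y. norm (w - c *\<^sub>R y) \<partial>uniform_sphere)) / 2"
    by (subst integral_measure_pmf[where A = "{-1, 1}"]) (auto simp: set_r pmf_r)
  also have "\<dots> = (\<integral>y. (norm (w + c *\<^sub>R y) + norm (w - c *\<^sub>R y)) / 2 \<partial>uniform_sphere)"
    using integrable_uniform_sphere_norm[of w c] integrable_uniform_sphere_norm[of w "- c"] by simp
  finally show ?thesis .
qed

theorem lemma15:
  fixes x :: "nat \<Rightarrow> 'a::euclidean_space"
    and \<epsilon> :: "nat \<Rightarrow> real"
    and C :: real
    and X :: "'a set"
    and T t :: nat
  assumes "X = cball 0 1"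
    and "C = 4 * sqrt 2"
    and "t \<in> {1..T}"
    and "\<And>i. i \<in> {1..T} - {t} \<Longrightarrow> x i \<in> X"
    and "\<And>i. i \<in> {t+1..T} \<Longrightarrow> \<epsilon> i \<in> {-1, 1}"
  shows "(SUP p \<in> prob_dists X.
            ereal (\<integral>y. norm (C *\<^sub>R (\<Sum>i=t+1..T. \<epsilon> i *\<^sub>R x i) - (\<Sum>i=1..t-1. x i)
                            + (\<integral>z. z \<partial>p) - y) \<partial>p))
         \<le> ereal (\<integral>(e, y). norm (C *\<^sub>R (\<Sum>i=t..T. (\<epsilon>(t := e)) i *\<^sub>R (x(t := y)) i)
                                - (\<Sum>i=1..t-1. x i))
                   \<partial>(measure_pmf rademacher \<Otimes>\<^sub>M (uniform_sphere :: 'a measure)))"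
proof -
  define w where "w = C *\<^sub>R (\<Sum>i=t+1..T. \<epsilon> i *\<^sub>R x i) - (\<Sum>i=1..t-1. x i)"
  \<comment> \<open>The first fact gives \<open>C ^ 2 \<ge> 4\<close> for dimension at least two,
    the second matches the constant 4 of dimension one.\<close>
  have C: "C\<^sup>2 = 32" "C \<ge> 4"
    using assms(2) by (simp_all add: power_mult_distrib)
  have "C *\<^sub>R (\<Sum>i=t..T. (\<epsilon>(t := e)) i *\<^sub>R (x(t := y)) i) - (\<Sum>i=1..t-1. x i) = w + (C * e) *\<^sub>R y" for e y
  proof -
    \<comment> \<open>The summand at \<open>t\<close> carries both random variables and exists
      because \<open>t \<le> T\<close>; the function updates do not affect later indices.\<close>
    have "(\<Sum>i=t..T. (\<epsilon>(t := e)) i *\<^sub>R (x(t := y)) i)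
        = e *\<^sub>R y + (\<Sum>i=t+1..T. (\<epsilon>(t := e)) i *\<^sub>R (x(t := y)) i)"
      using assms(3) by (subst sum.atLeast_Suc_atMost) simp_all
    also have "(\<Sum>i=t+1..T. (\<epsilon>(t := e)) i *\<^sub>R (x(t := y)) i) = (\<Sum>i=t+1..T. \<epsilon> i *\<^sub>R x i)"
      by (intro sum.cong) auto
    finally show ?thesis
      by (simp add: w_def algebra_simps)
  qed
  then have rhs: "(\<integral>(e, y). norm (C *\<^sub>R (\<Sum>i=t..T. (\<epsilon>(t := e)) i *\<^sub>R (x(t := y)) i) - (\<Sum>i=1..t-1. x i))
        \<partial>(measure_pmf rademacher \<Otimes>\<^sub>M (uniform_sphere :: 'a measure)))
      = (\<integral>y. (norm (w + C *\<^sub>R y) + norm (w - C *\<^sub>R y)) / 2 \<partial>uniform_sphere)" (is "?rhs = ?avg")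
    by (simp only: integral_rademacher_uniform_sphere)
  have "(\<integral>y. norm (w + (\<integral>z. z \<partial>p) - y) \<partial>p) \<le> ?avg" if p: "p \<in> prob_dists (cball 0 1)" for p
  proof (cases "DIM('a) = 1")
    case True
    then show ?thesis
      using prob_dists_cball_norm_le_max_dim1[OF p True, of w] uniform_sphere_average_ge_max[of C w] C
      by linarith
  next
    case False
    then have "DIM('a) \<ge> 2"
      using DIM_positive[where 'a = 'a] by linarith
    then show ?thesis
      using prob_dists_cball_norm_le_sqrt[OF p, of w] uniform_sphere_average_ge_sqrt[of C w] C
      by linarith
  qed
  then show ?thesis
    \<comment> \<open>The supremum is taken in \<open>ereal\<close>, so the bound uniform in
      \<open>p\<close> passes to it directly.\<close>
    unfolding rhs assms(1) by (intro SUP_least) (simp add: w_def)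
qed

end
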